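(* The set species $\mathrm{SF}$ of grounded set families admits the structure of a commutative (connected) Hopf monoid in set species, with product given by join, $\mathcal{F}_1\cdot\mathcal{F}_2=\mathcal{F}_1*\mathcal{F}_2$, and coproduct given, for each decomposition $I=S\sqcup T$, by $\Delta_{S,T}(\mathcal{F})=(\mathcal{F}|_S,\ \mathcal{F}/_S)$.
   Context: A grounded set family on a finite set $I$ is a pair $(\mathcal{F},I)$ with $\mathcal{F}\subseteq 2^I$ and $\emptyset\in\mathcal{F}$; elements of $I$ lying in no member of $\mathcal{F}$ are allowed (they are called phantoms). The set species $\mathrm{SF}$ sends a finite set $I$ to the set $\mathrm{SF}[I]$ of grounded set families on $I$, and a bijection $I\to J$ to the induced relabeling. For disjoint $I_1,I_2$, the join is $(\mathcal{F}_1,I_1)*(\mathcal{F}_2,I_2)=(\{X\cup Y: X\in\mathcal{F}_1,\ Y\in\mathcal{F}_2\},\ I_1\cup I_2)$. For $I=S\sqcup T$, the restriction is $\mathcal{F}|_S=\{F\cap S: F\in\mathcal{F}\}$ with ground set $S$, and the contraction is $\mathcal{F}/_S=\{F\in\mathcal{F}: F\cap S=\emptyset\}$ with ground set $T$. A Hopf monoid in set species (in the sense of Aguiar–Mahajan) is a functor $\mathrm{H}$ from finite sets with bijections to sets together with maps $\mu_{S,T}:\mathrm{H}[S]\times\mathrm{H}[T]\to\mathrm{H}[I]$ and $\Delta_{S,T}:\mathrm{H}[I]\to\mathrm{H}[S]\times\mathrm{H}[T]$ for every decomposition $I=S\sqcup T$, satisfying the axioms of naturality, unitality, associativity, coassociativity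 and compatibility; it is connected if $|\mathrm{H}[\emptyset]|=1$, and commutative if $\mu_{S,T}(x,y)=\mu_{T,S}(y,x)$. *)

theory Defs
  imports Main
begin

text \<open>
  Finite sets are rendered as finite subsets of an arbitrary type \<open>'a\<close>. A bijection
  \<open>I \<rightarrow> J\<close> is a total function \<open>\<sigma>\<close> with \<open>bij_betw \<sigma> I J\<close>; since the values of \<open>\<sigma>\<close>
  outside \<open>I\<close> are junk, the action is required to ignore them (\<open>act_cong\<close>).
  \<open>act I J \<sigma>\<close> is the value of the functor at \<open>\<sigma> : I \<rightarrow> J\<close>.
\<close>

locale set_species =
  fixes H :: "'a set \<Rightarrow> 'h set"
    and act :: "'a set \<Rightarrow> 'a set \<Rightarrow> ('a \<Rightarrow> 'a) \<Rightarrow> 'h \<Rightarrow> 'h"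
  assumes act_closed:
      "\<lbrakk>finite I; bij_betw \<sigma> I J; x \<in> H I\<rbrakk> \<Longrightarrow> act I J \<sigma> x \<in> H J"
    and act_cong:
      "\<lbrakk>finite I; bij_betw \<sigma> I J; \<And>i. i \<in> I \<Longrightarrow> \<sigma> i = \<tau> i; x \<in> H I\<rbrakk>
        \<Longrightarrow> act I J \<sigma> x = act I J \<tau> x"
    and act_id:
      "\<lbrakk>finite I; x \<in> H I\<rbrakk> \<Longrightarrow> act I I id x = x"
    and act_comp:
      "\<lbrakk>finite I; bij_betw \<sigma> I J; bij_betw \<tau> J K; x \<in> H I\<rbrakk>
        \<Longrightarrow> act I K (\<tau> \<circ> \<sigma>) x = act J K \<tau> (act I J \<sigma> x)"

text \<open>
  A decomposition \<open>I = S \<squnion> T\<close> is given by its two disjoint (possibly empty) blocks.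
  The unit is the element \<open>e\<close> of \<open>H {}\<close>; the counit is the unique map from \<open>H {}\<close> to a
  singleton, so the counit laws say that the \<open>I\<close>-component of \<open>\<Delta>\<close> at the decompositions
  \<open>I = I \<squnion> {}\<close> and \<open>I = {} \<squnion> I\<close> is the identity. No antipode is part of the data: in the
  connected case it exists automatically after linearization.
\<close>

locale set_hopf_monoid = set_species H act
  for H :: "'a set \<Rightarrow> 'h set"
    and act :: "'a set \<Rightarrow> 'a set \<Rightarrow> ('a \<Rightarrow> 'a) \<Rightarrow> 'h \<Rightarrow> 'h" +
  fixes e :: 'h
    and \<mu> :: "'a set \<Rightarrow> 'a set \<Rightarrow> 'h \<Rightarrow> 'h \<Rightarrow> 'h"
    and \<Delta> :: "'a set \<Rightarrow> 'a set \<Rightarrow> 'h \<Rightarrow> 'h \<times> 'h"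
  assumes unit_closed: "e \<in> H {}"
    and mult_closed:
      "\<lbrakk>finite S; finite T; S \<inter> T = {}; x \<in> H S; y \<in> H T\<rbrakk> \<Longrightarrow> \<mu> S T x y \<in> H (S \<union> T)"
    and comult_closed:
      "\<lbrakk>finite S; finite T; S \<inter> T = {}; z \<in> H (S \<union> T)\<rbrakk> \<Longrightarrow> \<Delta> S T z \<in> H S \<times> H T"
    and mult_natural:
      "\<lbrakk>finite S; finite T; S \<inter> T = {}; bij_betw \<sigma> (S \<union> T) J; x \<in> H S; y \<in> H T\<rbrakk>
        \<Longrightarrow> act (S \<union> T) J \<sigma> (\<mu> S T x y)
          = \<mu> (\<sigma> ` S) (\<sigma> ` T) (act S (\<sigma> ` S) \<sigma> x) (act T (\<sigma> ` T) \<sigma> y)"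
    and comult_natural:
      "\<lbrakk>finite S; finite T; S \<inter> T = {}; bij_betw \<sigma> (S \<union> T) J; z \<in> H (S \<union> T)\<rbrakk>
        \<Longrightarrow> \<Delta> (\<sigma> ` S) (\<sigma> ` T) (act (S \<union> T) J \<sigma> z)
          = map_prod (act S (\<sigma> ` S) \<sigma>) (act T (\<sigma> ` T) \<sigma>) (\<Delta> S T z)"
    and mult_unit_left: "\<lbrakk>finite I; x \<in> H I\<rbrakk> \<Longrightarrow> \<mu> {} I e x = x"
    and mult_unit_right: "\<lbrakk>finite I; x \<in> H I\<rbrakk> \<Longrightarrow> \<mu> I {} x e = x"
    and comult_counit_left: "\<lbrakk>finite I; z \<in> H I\<rbrakk> \<Longrightarrow> snd (\<Delta> {} I z) = z"
    and comult_counit_right: "\<lbrakk>finite I; z \<in> H I\<rbrakk> \<Longrightarrow> fst (\<Delta> I {} z) = z"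
    and mult_assoc:
      "\<lbrakk>finite R; finite S; finite T; R \<inter> S = {}; R \<inter> T = {}; S \<inter> T = {};
        x \<in> H R; y \<in> H S; z \<in> H T\<rbrakk>
        \<Longrightarrow> \<mu> (R \<union> S) T (\<mu> R S x y) z = \<mu> R (S \<union> T) x (\<mu> S T y z)"
    and comult_coassoc:
      "\<lbrakk>finite R; finite S; finite T; R \<inter> S = {}; R \<inter> T = {}; S \<inter> T = {};
        z \<in> H (R \<union> S \<union> T)\<rbrakk>
        \<Longrightarrow> (case \<Delta> (R \<union> S) T z of (u, c) \<Rightarrow> case \<Delta> R S u of (a, b) \<Rightarrow> (a, b, c))
          = (case \<Delta> R (S \<union> T) z of (a, v) \<Rightarrow> case \<Delta> S T v of (b, c) \<Rightarrow> (a, b, c))"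
    and compatible:
      "\<lbrakk>finite S; finite T; S \<inter> T = {}; S' \<inter> T' = {}; S \<union> T = S' \<union> T'; x \<in> H S; y \<in> H T\<rbrakk>
        \<Longrightarrow> \<Delta> S' T' (\<mu> S T x y)
          = (case \<Delta> (S \<inter> S') (S \<inter> T') x of (a, b) \<Rightarrow>
             case \<Delta> (T \<inter> S') (T \<inter> T') y of (c, d) \<Rightarrow>
               (\<mu> (S \<inter> S') (T \<inter> S') a c, \<mu> (S \<inter> T') (T \<inter> T') b d))"

locale connected_set_hopf_monoid = set_hopf_monoid +
  assumes connected: "card (H {}) = 1"

locale commutative_set_hopf_monoid = set_hopf_monoid +
  assumes commutative:
    "\<lbrakk>finite S; finite T; S \<inter> T = {}; x \<in> H S; y \<in> H T\<rbrakk> \<Longrightarrow> \<mu> S T x y = \<mu> T S y x"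

type_synonym 'a set_family = "'a set set \<times> 'a set"

definition SF :: "'a set \<Rightarrow> 'a set_family set" where
  "SF I = {(F, J). J = I \<and> F \<subseteq> Pow J \<and> {} \<in> F}"

definition relabel :: "('a \<Rightarrow> 'a) \<Rightarrow> 'a set_family \<Rightarrow> 'a set_family" where
  "relabel \<sigma> = (\<lambda>(F, I). ((\<lambda>X. \<sigma> ` X) ` F, \<sigma> ` I))"

definition join :: "'a set_family \<Rightarrow> 'a set_family \<Rightarrow> 'a set_family" where
  "join = (\<lambda>(F\<^sub>1, I\<^sub>1) (F\<^sub>2, I\<^sub>2). ({X \<union> Y | X Y. X \<in> F\<^sub>1 \<and> Y \<in> F\<^sub>2}, I\<^sub>1 \<union> I\<^sub>2))"

definition restriction :: "'a set_family \<Rightarrow> 'a set \<Rightarrow> 'a set_family" where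
  "restriction = (\<lambda>(F, I) S. ({X \<inter> S | X. X \<in> F}, S))"

definition contraction :: "'a set_family \<Rightarrow> 'a set \<Rightarrow> 'a set_family" where
  "contraction = (\<lambda>(F, I) S. ({X \<in> F. X \<inter> S = {}}, I - S))"

end

theory Submission
  imports Defs
begin

text \<open>Every axiom reduces to an identity about single members of a family. For compatibility,
  take X \<subseteq> S and Y \<subseteq> T: cutting X \<union> Y down to S' cuts X to S \<inter> S'
  and Y to T \<inter> S', and X \<union> Y avoids S' exactly when X avoids S \<inter> S' and Y
  avoids T \<inter> S'. So restriction and contraction both distribute over join
  (\<open>restriction_join\<close>, \<open>contraction_join\<close>). Coassociativity compares three
  components: nested restrictions collapse, successive contractions merge, and in the middle block
  restricting and contracting commute (\<open>contraction_restriction\<close>). Naturality of the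
  coproduct rests on injectivity, which makes images commute with intersections. The product axioms
  are the monoid laws of union, applied memberwise.\<close>

lemma mem_SF [simp]: "(F, J) \<in> SF I \<longleftrightarrow> J = I \<and> F \<subseteq> Pow I \<and> {} \<in> F"
  by (auto simp: SF_def)

lemma SF_E:
  assumes "x \<in> SF I"
  obtains F where "x = (F, I)" "F \<subseteq> Pow I" "{} \<in> F"
  using assms by (auto simp: SF_def)

lemma relabel_Pair [simp]: "relabel \<sigma> (F, I) = ((\<lambda>X. \<sigma> ` X) ` F, \<sigma> ` I)"
  by (simp add: relabel_def)

lemma join_Pair [simp]: "join (F, I) (G, J) = ({X \<union> Y | X Y. X \<in> F \<and> Y \<in> G}, I \<union> J)"
  by (simp add: join_def)

text \<open>The image form, in place of the set comprehension, lets \<open>image_image\<close> and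
  \<open>image_cong\<close> work on restrictions.\<close>

lemma restriction_Pair [simp]: "restriction (F, I) S = ((\<lambda>X. X \<inter> S) ` F, S)"
  by (auto simp: restriction_def)

lemma contraction_Pair [simp]: "contraction (F, I) S = ({X \<in> F. X \<inter> S = {}}, I - S)"
  by (simp add: contraction_def)

text \<open>This gives connectedness: only two families live on the empty ground set, and
  groundedness excludes the one without members.\<close>

lemma SF_empty: "SF {} = {({{}}, {})}"
  by (auto simp: SF_def)

lemma relabel_in_SF:
  assumes "x \<in> SF I"
  shows "relabel \<sigma> x \<in> SF (\<sigma> ` I)"
  using assms by (elim SF_E) auto

text \<open>Members of the family are subsets of \<open>I\<close>, so values of the bijection
  outside \<open>I\<close> never enter.\<close>

lemma relabel_cong:
  assumes x: "x \<in> SF I" and eq: "\<And>i. i \<in> I \<Longrightarrow> \<sigma> i = \<tau> i"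
  shows "relabel \<sigma> x = relabel \<tau> x"
proof -
  obtain F where x': "x = (F, I)" and F: "F \<subseteq> Pow I"
    using x by (elim SF_E)
  have "\<sigma> ` X = \<tau> ` X" if "X \<in> F" for X
    using that eq F by (intro image_cong) auto
  then have "(`) \<sigma> ` F = (`) \<tau> ` F"
    by (rule image_cong [OF refl])
  moreover have "\<sigma> ` I = \<tau> ` I"
    using eq by (rule image_cong [OF refl])
  ultimately show ?thesis
    by (simp add: x')
qed

lemma relabel_id [simp]: "relabel id x = x"
  by (cases x) simp

lemma relabel_comp: "relabel (\<tau> \<circ> \<sigma>) x = relabel \<tau> (relabel \<sigma> x)"
  by (cases x) (simp add: image_image image_comp comp_def)

lemma join_in_SF:
  assumes "x \<in> SF S" "y \<in> SF T"
  shows "join x y \<in> SF (S \<union> T)"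
  using assms by (elim SF_E) auto

lemma restriction_in_SF:
  assumes "z \<in> SF I"
  shows "restriction z S \<in> SF S"
  using assms by (elim SF_E) auto

lemma contraction_in_SF:
  assumes "z \<in> SF I"
  shows "contraction z S \<in> SF (I - S)"
  using assms by (elim SF_E) auto

lemma relabel_join: "relabel \<sigma> (join x y) = join (relabel \<sigma> x) (relabel \<sigma> y)"
proof -
  obtain F I G J where x: "x = (F, I)" and y: "y = (G, J)"
    by (cases x; cases y)
  have "(`) \<sigma> ` {X \<union> Y | X Y. X \<in> F \<and> Y \<in> G} = {\<sigma> ` (X \<union> Y) | X Y. X \<in> F \<and> Y \<in> G}"
    by blast
  also have "\<dots> = {X \<union> Y | X Y. X \<in> (`) \<sigma> ` F \<and> Y \<in> (`) \<sigma> ` G}"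
    unfolding image_Un by blast
  finally show ?thesis
    by (simp add: x y image_Un)
qed

lemma restriction_relabel:
  assumes "inj_on \<sigma> I" "S \<subseteq> I" "z \<in> SF I"
  shows "restriction (relabel \<sigma> z) (\<sigma> ` S) = relabel \<sigma> (restriction z S)"
proof -
  obtain F where z: "z = (F, I)" and F: "F \<subseteq> Pow I"
    using assms(3) by (elim SF_E)
  \<comment> \<open>Injectivity on \<open>I\<close> applies because both \<open>X\<close> and
    \<open>S\<close> lie inside \<open>I\<close>.\<close>
  have "\<sigma> ` X \<inter> \<sigma> ` S = \<sigma> ` (X \<inter> S)" if "X \<in> F" for X
    using that F assms(2) by (intro inj_on_image_Int [OF assms(1), symmetric]) auto
  then show ?thesis
    by (auto simp: z image_image intro!: image_cong)
qed

lemma contraction_relabel: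
  assumes "inj_on \<sigma> I" "S \<subseteq> I" "z \<in> SF I"
  shows "contraction (relabel \<sigma> z) (\<sigma> ` S) = relabel \<sigma> (contraction z S)"
proof -
  obtain F where z: "z = (F, I)" and F: "F \<subseteq> Pow I"
    using assms(3) by (elim SF_E)
  \<comment> \<open>Injectivity ensures that relabeling creates no new intersections, so the same
    members survive contraction before and after it.\<close>
  have disj: "\<sigma> ` X \<inter> \<sigma> ` S = {} \<longleftrightarrow> X \<inter> S = {}" if "X \<in> F" for X
  proof -
    have "\<sigma> ` (X \<inter> S) = \<sigma> ` X \<inter> \<sigma> ` S"
      using that F assms(2) by (intro inj_on_image_Int [OF assms(1)]) auto
    then show ?thesis
      by (metis image_is_empty)
  qed
  have "{Y \<in> (`) \<sigma> ` F. Y \<inter> \<sigma> ` S = {}} = (`) \<sigma> ` {X \<in> F. X \<inter> S = {}}"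
    using disj by blast
  moreover have "\<sigma> ` I - \<sigma> ` S = \<sigma> ` (I - S)"
    using assms(1,2) by (simp add: inj_on_image_set_diff)
  ultimately show ?thesis
    by (simp add: z)
qed

lemma join_unit_left [simp]: "join ({{}}, {}) x = x"
  by (cases x) simp

lemma join_commute: "join x y = join y x"
proof -
  have "{X \<union> Y | X Y. X \<in> F \<and> Y \<in> G} = {X \<union> Y | X Y. X \<in> G \<and> Y \<in> F}" for F G :: "'a set set"
    using Un_commute by blast
  then show ?thesis
    by (cases x; cases y) (simp add: Un_commute)
qed

lemma join_unit_right [simp]: "join x ({{}}, {}) = x"
  by (simp add: join_commute [of x])

lemma join_assoc: "join (join x y) z = join x (join y z)"
proof -
  obtain F I G J H K where x: "x = (F, I)" and y: "y = (G, J)" and z: "z = (H, K)"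
    by (cases x; cases y; cases z)
  \<comment> \<open>Both bracketings are compared with the family of triple unions.\<close>
  have "{A \<union> Z | A Z. A \<in> {X \<union> Y | X Y. X \<in> F \<and> Y \<in> G} \<and> Z \<in> H} =
        {X \<union> Y \<union> Z | X Y Z. X \<in> F \<and> Y \<in> G \<and> Z \<in> H}"
    by blast
  also have "\<dots> = {X \<union> B | X B. X \<in> F \<and> B \<in> {Y \<union> Z | Y Z. Y \<in> G \<and> Z \<in> H}}"
    unfolding Un_assoc by blast
  finally show ?thesis
    by (simp only: x y z join_Pair Un_assoc)
qed

lemma restriction_ground:
  assumes "z \<in> SF I"
  shows "restriction z I = z"
proof -
  obtain F where z: "z = (F, I)" and F: "F \<subseteq> Pow I"
    using assms by (elim SF_E)
  \<comment> \<open>Writing \<open>F\<close> as an image under the identity reduces the claim to X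
    \<inter> I = X for each member.\<close>
  have "(\<lambda>X. X \<inter> I) ` F = (\<lambda>X. X) ` F"
    using F by (intro image_cong) auto
  then show ?thesis
    by (simp add: z)
qed

lemma contraction_empty [simp]: "contraction z {} = z"
  by (cases z) simp

lemma restriction_restriction:
  assumes "R \<subseteq> S"
  shows "restriction (restriction z S) R = restriction z R"
proof -
  have "X \<inter> S \<inter> R = X \<inter> R" for X
    using assms by blast
  then show ?thesis
    by (cases z) (simp add: image_image)
qed

lemma contraction_contraction: "contraction (contraction z R) S = contraction z (R \<union> S)"
  by (cases z) auto

text \<open>The middle component of coassociativity. Intersecting with R \<union> S does not change
  whether a member meets \<open>R\<close>, and a member that avoids \<open>R\<close> has the same
  trace on R \<union> S as on \<open>S\<close>. Disjointness serves to match the ground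
  sets.\<close>

lemma contraction_restriction:
  assumes "R \<inter> S = {}"
  shows "contraction (restriction z (R \<union> S)) R = restriction (contraction z R) S"
proof -
  obtain F I where z: "z = (F, I)"
    by (cases z)
  have "{Y \<in> (\<lambda>X. X \<inter> (R \<union> S)) ` F. Y \<inter> R = {}} =
        (\<lambda>X. X \<inter> (R \<union> S)) ` {X \<in> F. X \<inter> (R \<union> S) \<inter> R = {}}"
    by blast
  also have "\<dots> = (\<lambda>X. X \<inter> S) ` {X \<in> F. X \<inter> R = {}}"
  proof (rule image_cong)
    have "X \<inter> (R \<union> S) \<inter> R = X \<inter> R" for X
      by blast
    then show "{X \<in> F. X \<inter> (R \<union> S) \<inter> R = {}} = {X \<in> F. X \<inter> R = {}}"
      by simp
  \<comment> \<open>The remaining goal is that the two maps agree on members avoiding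
    \<open>R\<close>.\<close>
  qed blast
  finally have "{Y \<in> (\<lambda>X. X \<inter> (R \<union> S)) ` F. Y \<inter> R = {}} = (\<lambda>X. X \<inter> S) ` {X \<in> F. X \<inter> R = {}}" .
  moreover have "R \<union> S - R = S"
    using assms by blast
  ultimately show ?thesis
    by (simp add: z)
qed

lemma restriction_join:
  assumes "x \<in> SF S" "y \<in> SF T" "S' \<subseteq> S \<union> T"
  shows "restriction (join x y) S' = join (restriction x (S \<inter> S')) (restriction y (T \<inter> S'))"
proof -
  obtain F G where x: "x = (F, S)" "F \<subseteq> Pow S" and y: "y = (G, T)" "G \<subseteq> Pow T"
    using assms(1,2) by (elim SF_E)
  have eq: "(X \<union> Y) \<inter> S' = X \<inter> (S \<inter> S') \<union> Y \<inter> (T \<inter> S')" if "X \<in> F" "Y \<in> G" for X Y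
    using that x y by blast
  have "(\<lambda>Z. Z \<inter> S') ` {X \<union> Y | X Y. X \<in> F \<and> Y \<in> G} = {(X \<union> Y) \<inter> S' | X Y. X \<in> F \<and> Y \<in> G}"
    by blast
  also have "\<dots> = {X \<inter> (S \<inter> S') \<union> Y \<inter> (T \<inter> S') | X Y. X \<in> F \<and> Y \<in> G}"
    using eq by metis
  also have "\<dots> = {X \<union> Y | X Y. X \<in> (\<lambda>X. X \<inter> (S \<inter> S')) ` F \<and> Y \<in> (\<lambda>Y. Y \<inter> (T \<inter> S')) ` G}"
    by blast
  finally show ?thesis
    \<comment> \<open>The inclusion of \<open>S'\<close> in S \<union> T makes the ground sets
      agree: the traces of \<open>S'\<close> on \<open>S\<close> and \<open>T\<close> together cover
      \<open>S'\<close>.\<close>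
    using assms(3) by (auto simp: x y)
qed

text \<open>A union avoids \<open>S'\<close> exactly when both of its parts do, so the selection
  splits into independent conditions on X and Y.\<close>

lemma contraction_join:
  assumes "x \<in> SF S" "y \<in> SF T"
  shows "contraction (join x y) S' = join (contraction x (S \<inter> S')) (contraction y (T \<inter> S'))"
proof -
  obtain F G where x: "x = (F, S)" "F \<subseteq> Pow S" and y: "y = (G, T)" "G \<subseteq> Pow T"
    using assms(1,2) by (elim SF_E)
  have eq: "X \<in> F \<and> Y \<in> G \<and> (X \<union> Y) \<inter> S' = {} \<longleftrightarrow>
      X \<in> {X \<in> F. X \<inter> (S \<inter> S') = {}} \<and> Y \<in> {Y \<in> G. Y \<inter> (T \<inter> S') = {}}" for X Y
    using x y by blast
  have "{Z \<in> {X \<union> Y | X Y. X \<in> F \<and> Y \<in> G}. Z \<inter> S' = {}} =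
        {X \<union> Y | X Y. X \<in> {X \<in> F. X \<inter> (S \<inter> S') = {}} \<and> Y \<in> {Y \<in> G. Y \<inter> (T \<inter> S') = {}}}"
    unfolding eq [symmetric] by blast
  moreover have "S \<union> T - S' = (S - S \<inter> S') \<union> (T - T \<inter> S')"
    by blast
  ultimately show ?thesis
    by (simp only: x y join_Pair contraction_Pair)
qed

text \<open>A family carries its ground set, so relabeling and join can ignore the index sets, and
  the coproduct can read the second block off as the complement of the first.\<close>

lemma set_hopf_monoid_SF:
  "set_hopf_monoid (SF :: 'a set \<Rightarrow> 'a set_family set) (\<lambda>I J. relabel)
     ({{}}, {}) (\<lambda>S T. join) (\<lambda>S T F. (restriction F S, contraction F S))"
proof (unfold_locales, goal_cases)
  case 1
  then show ?case by (metis bij_betw_imp_surj_on relabel_in_SF)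
next
  case 2
  then show ?case by (metis relabel_cong)
next
  case 4
  then show ?case by (simp add: relabel_comp)
next
  case 6
  then show ?case by (simp add: join_in_SF)
next
  case (7 S T z)
  \<comment> \<open>Contraction produces the ground set I - S; disjointness of the blocks identifies
    it with \<open>T\<close>.\<close>
  then have "S \<union> T - S = T"
    by blast
  with 7 show ?case
    by (metis restriction_in_SF contraction_in_SF mem_Sigma_iff)
next
  case 8
  then show ?case by (simp add: relabel_join)
next
  case (9 S T \<sigma> J z)
  then have "inj_on \<sigma> (S \<union> T)"
    by (simp add: bij_betw_imp_inj_on)
  from restriction_relabel [OF this _ 9(5)] contraction_relabel [OF this _ 9(5)] show ?case
    by simp
next
  case 13
  then show ?case by (simp add: restriction_ground)
next
  case 14
  then show ?case by (simp add: join_assoc)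
next
  case 15
  then show ?case
    by (simp add: restriction_restriction contraction_restriction contraction_contraction)
next
  case (16 S T S' T' x y)
  then have "S' \<subseteq> S \<union> T"
    by blast
  with 16 show ?case by (simp add: restriction_join contraction_join)
\<comment> \<open>What remains is the identity law, membership of the unit, the two unit laws and
  the left counit law, all covered by simplification rules.\<close>
qed simp_all

theorem theorem3p3:
  shows "connected_set_hopf_monoid (SF :: 'a set \<Rightarrow> 'a set_family set) (\<lambda>I J. relabel)
           ({{}}, {}) (\<lambda>S T. join) (\<lambda>S T F. (restriction F S, contraction F S))
       \<and> commutative_set_hopf_monoid (SF :: 'a set \<Rightarrow> 'a set_family set) (\<lambda>I J. relabel)
           ({{}}, {}) (\<lambda>S T. join) (\<lambda>S T F. (restriction F S, contraction F S))"
proof -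
  interpret set_hopf_monoid "SF :: 'a set \<Rightarrow> 'a set_family set" "\<lambda>I J. relabel" "({{}}, {})"
    "\<lambda>S T. join" "\<lambda>S T F. (restriction F S, contraction F S)"
    by (rule set_hopf_monoid_SF)
  show ?thesis
    \<comment> \<open>With the Hopf monoid interpreted, each conjunct leaves just its additional
      axiom: connectedness, then commutativity.\<close>
    by (intro conjI; unfold_locales) (simp add: SF_empty, rule join_commute)
qed

end
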